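(* For each $t\in\mathbb{N}$ let $G_t$ be a balanceable graph of order $n(t)$ and with $e(t)$ edges, where $n(x)$ and $e(x)$ are monotonically increasing functions of $x>0$. If $n(t)^{2-\frac1s} = o(e(t))$ (as $t\to\infty$) for some integer $s \ge 2$, then $\mathrm{bal}(n,G_t) = \Omega(n^{2-\frac1s})$ (as $n\to\infty$, for $t$ sufficiently large).
   Context: For a graph $G$ with $e(G)$ edges, a $2$-edge-coloring (red/blue) of $K_n$ contains a balanced copy of $G$ if there is a subgraph of $K_n$ isomorphic to $G$ in which one of the colors is assigned to exactly $\lfloor e(G)/2\rfloor$ of its edges. The balancing number $\mathrm{bal}(n,G)$ is the minimum integer $k$ such that every $2$-edge-coloring of $K_n$ with more than $k$ edges in each color contains a balanced copy of $G$, and $\mathrm{bal}(n,G)=\infty$ if no such $k$ exists. $G$ is balanceable if $\mathrm{bal}(n,G)$ is finite for every sufficiently large $n$. *)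

theory Defs
  imports
    Complex_Main
    "HOL-Library.Extended_Nat"
    "HOL-Library.Landau_Symbols"
    "HOL-Library.Ramsey"
begin

record 'a ugraph =
  verts :: "'a set"
  edges :: "'a set set"

definition finite_simple_graph :: "'a ugraph \<Rightarrow> bool" where
  "finite_simple_graph G \<longleftrightarrow>
     finite (verts G) \<and> verts G \<noteq> {} \<and> edges G \<subseteq> [verts G]\<^bsup>2\<^esup>"

definition complete_graph :: "nat \<Rightarrow> nat ugraph" where
  "complete_graph n = \<lparr>verts = {..<n}, edges = [{..<n}]\<^bsup>2\<^esup>\<rparr>"

definition subgraph :: "'a ugraph \<Rightarrow> 'a ugraph \<Rightarrow> bool" where
  "subgraph H G \<longleftrightarrow>
     finite_simple_graph H \<and> verts H \<subseteq> verts G \<and> edges H \<subseteq> edges G"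

definition graph_iso :: "'a ugraph \<Rightarrow> 'b ugraph \<Rightarrow> bool" where
  "graph_iso G H \<longleftrightarrow>
     (\<exists>f. bij_betw f (verts G) (verts H) \<and> edges H = (\<lambda>e. f ` e) ` edges G)"

datatype colour = Red | Blue

text \<open>A colouring is a total function on sets of vertices; only its values on the edges
  of the complete graph are ever used.\<close>

definition more_than_each :: "nat \<Rightarrow> nat \<Rightarrow> (nat set \<Rightarrow> colour) \<Rightarrow> bool" where
  "more_than_each n k c \<longleftrightarrow> (\<forall>x. card {e \<in> edges (complete_graph n). c e = x} > k)"

definition balanced_copy :: "nat \<Rightarrow> (nat set \<Rightarrow> colour) \<Rightarrow> 'a ugraph \<Rightarrow> bool" where
  "balanced_copy n c G \<longleftrightarrow>
     (\<exists>H. subgraph H (complete_graph n) \<and> graph_iso G H \<and>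
          (\<exists>x. card {e \<in> edges H. c e = x} = card (edges G) div 2))"

text \<open>Only those \<open>k\<close> count for which some colouring has more than \<open>k\<close> edges in each
  colour: for larger \<open>k\<close> the requirement is vacuous, so without this restriction the
  balancing number would always be finite and every graph would be balanceable.
  The infimum of the empty set is \<open>\<infinity>\<close>.\<close>

definition bal :: "nat \<Rightarrow> 'a ugraph \<Rightarrow> enat" where
  "bal n G = Inf {enat k | k.
     (\<exists>c. more_than_each n k c) \<and>
     (\<forall>c. more_than_each n k c \<longrightarrow> balanced_copy n c G)}"

definition balanceable :: "'a ugraph \<Rightarrow> bool" where
  "balanceable G \<longleftrightarrow> (\<forall>\<^sub>F n in sequentially. bal n G \<noteq> \<infinity>)"

text \<open>For a balanceable graph the balancing number is eventually finite, so the unspecified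
  value of \<^const>\<open>the_enat\<close> at \<open>\<infinity>\<close> does not affect asymptotic statements.\<close>

definition bal_real :: "nat \<Rightarrow> 'a ugraph \<Rightarrow> real" where
  "bal_real n G = real (the_enat (bal n G))"

end

theory Submission
  imports Defs
begin

text \<open>
  This is the deletion method. Put \<open>m = n(t)\<close> and \<open>h = \<lfloor>e(t)/2\<rfloor>\<close>. A balanced copy has at
  least \<open>h\<close> red edges on \<open>m\<close> vertices, so it suffices to find a red graph with
  \<open>\<Omega>(n\<^bsup>2-1/s\<^esup>)\<close> edges in which no \<open>m\<close> vertices span \<open>h\<close> edges. Keeping each edge of \<open>K\<^sub>n\<close>
  with probability \<open>p\<close> of order \<open>n\<^bsup>-1/s\<^esup>\<close>, the expected number of forbidden \<open>h\<close>-sets of edges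
  is \<open>O(n\<^bsup>m\<^esup> p\<^bsup>h\<^esup>)\<close>, against about \<open>n\<^bsup>2\<^esup> p\<close> edges. Deleting one edge from each forbidden set
  leaves half of the edges once \<open>h - 1 \<ge> s (m - 2)\<close>, and this linear bound is all that is
  needed from the density hypothesis.
\<close>

section \<open>Random subsets and the deletion method\<close>

text \<open>The values on \<open>B\<close> are forced to be 0, and each of the other
  \<open>card E - card B\<close> values is chosen freely among \<open>L\<close>.\<close>

lemma card_PiE_containing:
  fixes L :: nat
  assumes "finite E" "B \<subseteq> E" "L > 0"
  shows "card {f \<in> E \<rightarrow>\<^sub>E {..<L}. B \<subseteq> {x \<in> E. f x = 0}} = L ^ (card E - card B)"
proof -
  have "{f \<in> E \<rightarrow>\<^sub>E {..<L}. B \<subseteq> {x \<in> E. f x = 0}} = (\<Pi>\<^sub>E x\<in>E. if x \<in> B then {0} else {..<L})"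
    (is "?A = ?P")
  proof
    show "?A \<subseteq> ?P"
      using assms by (auto simp: PiE_iff extensional_def)
    show "?P \<subseteq> ?A"
    proof
      fix f assume f: "f \<in> ?P"
      have "f x < L" if "x \<in> E" for x
        using PiE_mem[OF f that] assms(3) by (auto split: if_splits)
      moreover have "f x = 0" if "x \<in> B" for x
        using PiE_mem[OF f subsetD[OF assms(2) that]] that by simp
      ultimately show "f \<in> ?A"
        using f assms(2) by (auto simp: PiE_iff)
    qed
  qed
  then have "card {f \<in> E \<rightarrow>\<^sub>E {..<L}. B \<subseteq> {x \<in> E. f x = 0}}
      = (\<Prod>x\<in>E. if x \<in> B then 1 else L)"
    by (simp add: card_PiE[OF assms(1)] if_distrib cong: if_cong)
  also have "\<dots> = L ^ card (E - B)"
    using assms by (simp add: prod.If_cases Diff_eq)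
  finally show ?thesis
    using assms by (simp add: card_Diff_subset finite_subset)
qed

text \<open>Double counting of pairs (\<open>f\<close>, \<open>B\<close>). Divided by
  \<open>L ^ card E\<close>, this is the expected number of members of \<B> inside a random subset
  of density \<open>1/L\<close>.\<close>

lemma sum_card_contained:
  fixes L :: nat
  assumes "finite E" "\<B> \<subseteq> Pow E" "\<And>B. B \<in> \<B> \<Longrightarrow> card B = h" "L > 0"
  shows "(\<Sum>f\<in>E \<rightarrow>\<^sub>E {..<L}. card {B \<in> \<B>. B \<subseteq> {x \<in> E. f x = 0}})
    = card \<B> * L ^ (card E - h)"
proof -
  have fin: "finite \<B>" "finite (E \<rightarrow>\<^sub>E {..<L})"
    using assms finite_subset[of \<B> "Pow E"] by (auto intro: finite_PiE)
  have "(\<Sum>f\<in>E \<rightarrow>\<^sub>E {..<L}. card {B \<in> \<B>. B \<subseteq> {x \<in> E. f x = 0}})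
      = (\<Sum>B\<in>\<B>. card {f \<in> E \<rightarrow>\<^sub>E {..<L}. B \<subseteq> {x \<in> E. f x = 0}})"
    using sum_multicount_gen[OF fin(2) fin(1),
        of "\<lambda>f B. B \<subseteq> {x \<in> E. f x = 0}"
           "\<lambda>B. card {f \<in> E \<rightarrow>\<^sub>E {..<L}. B \<subseteq> {x \<in> E. f x = 0}}"]
    by simp
  also have "\<dots> = (\<Sum>B\<in>\<B>. L ^ (card E - h))"
    using assms by (intro sum.cong) (auto simp: card_PiE_containing)
  finally show ?thesis
    by simp
qed

text \<open>The random subset with density \<open>1/L\<close> is the zero set of a uniformly random function
  from \<open>E\<close> to \<open>{0, \<dots>, L - 1}\<close>.\<close>

lemma deletion_method:
  fixes L :: nat
  assumes fin: "finite E" and sub: "\<B> \<subseteq> Pow E" and card: "\<And>B. B \<in> \<B> \<Longrightarrow> card B = h"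
    and h: "h > 0" and L: "L > 0"
    and few: "2 * card \<B> \<le> card E * L ^ (h - 1)"
  obtains R where "R \<subseteq> E" "\<And>B. B \<in> \<B> \<Longrightarrow> \<not> B \<subseteq> R" "card E \<le> 2 * L * card R"
\<comment> \<open>If \<open>h\<close> exceeds \<open>card E\<close>, then nothing is forbidden and
  \<open>R = E\<close> works. Otherwise the truncated difference \<open>card E - h\<close> is a true
  one.\<close>
proof (cases "h \<le> card E")
  case False
  have "\<B> = {}"
  proof (intro equals0I)
    fix B assume B: "B \<in> \<B>"
    then have "card B \<le> card E"
      using sub fin by (intro card_mono) auto
    then show False
      using card[OF B] False by simp
  qed
  moreover have "card E * 1 \<le> card E * (2 * L)"
    using L by (intro mult_left_mono) auto
  ultimately show thesis
    using that[of E] by (simp add: mult_ac)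
next
  case True
  define F where "F = (E \<rightarrow>\<^sub>E {..<L})"
  define S where "S f = {x \<in> E. f x = 0}" for f :: "'a \<Rightarrow> nat"
  define bad where "bad f = {B \<in> \<B>. B \<subseteq> S f}" for f
  define N where "N = card E"
  have N: "N > 0"
    using True h by (simp add: N_def)
  have cardF: "card F = L ^ N"
    by (simp add: F_def N_def card_PiE[OF fin])
  have finF: "finite F"
    using fin by (auto simp: F_def intro: finite_PiE)
  \<comment> \<open>The size of \<open>S f\<close> is the number of singletons it contains, so the
    count of contained sets applies with size 1.\<close>
  have sumS: "(\<Sum>f\<in>F. card (S f)) = N * L ^ (N - 1)"
  proof -
    have "card (S f) = card {B \<in> (\<lambda>x. {x}) ` E. B \<subseteq> {x \<in> E. f x = 0}}" for f
    proof -
      have "{B \<in> (\<lambda>x. {x}) ` E. B \<subseteq> {x \<in> E. f x = 0}} = (\<lambda>x. {x}) ` S f"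
        by (auto simp: S_def)
      then show ?thesis
        by (simp add: card_image)
    qed
    moreover have "(\<Sum>f\<in>F. card {B \<in> (\<lambda>x. {x}) ` E. B \<subseteq> {x \<in> E. f x = 0}})
        = card ((\<lambda>x. {x}) ` E) * L ^ (N - 1)"
      unfolding F_def N_def using L by (intro sum_card_contained[OF fin]) auto
    ultimately show ?thesis
      by (simp add: N_def card_image)
  qed
  have sumB: "(\<Sum>f\<in>F. card (bad f)) = card \<B> * L ^ (N - h)"
    using sum_card_contained[OF fin sub card L] by (simp add: F_def N_def bad_def S_def)
  have pow: "L ^ (h - 1) * L ^ (N - h) = L ^ (N - 1)" "L * L ^ (N - 1) = L ^ N"
  proof -
    have "h - 1 + (N - h) = N - 1"
      using h True by (simp add: N_def)
    then show "L ^ (h - 1) * L ^ (N - h) = L ^ (N - 1)"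
      by (metis power_add)
    show "L * L ^ (N - 1) = L ^ N"
      using N by (cases N) auto
  qed
  \<comment> \<open>First moment argument: \<open>S f\<close> has mean size \<open>N/L\<close>, and
    by \<open>few\<close> the mean number of bad sets is at most \<open>N/(2L)\<close>. Some
    \<open>f\<close> does at least as well as the mean difference; the factor \<open>2 * L\<close>
    clears the denominators.\<close>
  have "\<exists>f\<in>F. N + 2 * L * card (bad f) \<le> 2 * L * card (S f)"
  proof (rule ccontr)
    assume "\<not> ?thesis"
    then have "(\<Sum>f\<in>F. 2 * L * card (S f)) < (\<Sum>f\<in>F. N + 2 * L * card (bad f))"
      using finF cardF L by (intro sum_strict_mono) (auto simp: not_le)
    then have "2 * L * (N * L ^ (N - 1)) < L ^ N * N + 2 * L * (card \<B> * L ^ (N - h))"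
      by (simp only: sum.distrib sum_constant cardF sumS sumB of_nat_id flip: sum_distrib_left)
    also have "2 * L * (card \<B> * L ^ (N - h)) = (2 * card \<B>) * (L * L ^ (N - h))"
      by simp
    also have "\<dots> \<le> (N * L ^ (h - 1)) * (L * L ^ (N - h))"
      using few by (intro mult_right_mono) (simp_all add: N_def)
    also have "\<dots> = N * (L * (L ^ (h - 1) * L ^ (N - h)))"
      by (simp only: mult_ac)
    also have "\<dots> = N * L ^ N"
      by (simp only: pow)
    also have "2 * L * (N * L ^ (N - 1)) = 2 * (N * (L * L ^ (N - 1)))"
      by (simp only: mult_ac)
    also have "\<dots> = 2 * (N * L ^ N)"
      by (simp only: pow)
    finally show False
      by (simp add: mult_ac)
  qed
  then obtain f where f: "N + 2 * L * card (bad f) \<le> 2 * L * card (S f)"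
    by blast
  \<comment> \<open>One element of each bad set is removed. The choice is proper because
    \<open>h > 0\<close> makes every member of \<B> nonempty.\<close>
  define R where "R = S f - (\<lambda>B. SOME x. x \<in> B) ` bad f"
  have fins: "finite (bad f)" "finite (S f)"
    using fin sub finite_subset[of \<B> "Pow E"] by (auto simp: bad_def S_def)
  show thesis
  proof
    show "R \<subseteq> E"
      by (auto simp: R_def S_def)
    show "\<not> B \<subseteq> R" if B: "B \<in> \<B>" for B
    proof
      assume "B \<subseteq> R"
      then have "B \<in> bad f"
        using B by (auto simp: bad_def R_def)
      moreover have "B \<noteq> {}"
        using card[OF B] h by auto
      then have "(SOME x. x \<in> B) \<in> B"
        by (simp add: some_in_eq)
      ultimately show False
        using \<open>B \<subseteq> R\<close> unfolding R_def by blast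
    qed
    have "card (S f) - card ((\<lambda>B. SOME x. x \<in> B) ` bad f) \<le> card R"
      unfolding R_def using fins by (intro diff_card_le_card_Diff) auto
    then have "card (S f) \<le> card R + card (bad f)"
      using card_image_le[OF fins(1), of "\<lambda>B. SOME x. x \<in> B"] by linarith
    then have "2 * L * card (S f) \<le> 2 * L * card R + 2 * L * card (bad f)"
      by (metis mult_le_mono2 distrib_left)
    then show "card E \<le> 2 * L * card R"
      using f by (simp add: N_def)
  qed
qed

section \<open>Locally sparse graphs with many edges\<close>

text \<open>Union bound over the vertex sets \<open>W\<close>, allowing edge sets of every size. The
  crude factor \<open>2 ^ (m choose 2)\<close> is harmless, since it does not depend on
  \<open>card V\<close>.\<close>

lemma card_spanned_le:
  assumes "finite V"
  shows "card {B \<in> [[V]\<^bsup>2\<^esup>]\<^bsup>h\<^esup>. \<exists>W\<in>[V]\<^bsup>m\<^esup>. B \<subseteq> [W]\<^bsup>2\<^esup>} \<le> card V ^ m * 2 ^ (m choose 2)"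
proof -
  have W: "finite W" "card W = m" if "W \<in> [V]\<^bsup>m\<^esup>" for W
    using that by (auto simp: nsets_def)
  have fin: "finite ([V]\<^bsup>m\<^esup>)"
    using assms by (rule finite_imp_finite_nsets)
  have finP: "finite (Pow ([W]\<^bsup>2\<^esup>))" if "W \<in> [V]\<^bsup>m\<^esup>" for W
    using W(1)[OF that] by (simp add: finite_imp_finite_nsets)
  have "card {B \<in> [[V]\<^bsup>2\<^esup>]\<^bsup>h\<^esup>. \<exists>W\<in>[V]\<^bsup>m\<^esup>. B \<subseteq> [W]\<^bsup>2\<^esup>} \<le> card (\<Union>W\<in>[V]\<^bsup>m\<^esup>. Pow ([W]\<^bsup>2\<^esup>))"
    using fin finP by (intro card_mono) auto
  also have "\<dots> \<le> (\<Sum>W\<in>[V]\<^bsup>m\<^esup>. card (Pow ([W]\<^bsup>2\<^esup>)))"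
    using fin by (rule card_UN_le)
  also have "\<dots> = (\<Sum>W\<in>[V]\<^bsup>m\<^esup>. 2 ^ (m choose 2))"
    using W by (intro sum.cong refl) (auto simp: card_Pow finite_imp_finite_nsets)
  also have "\<dots> = (card V choose m) * 2 ^ (m choose 2)"
    by simp
  also have "\<dots> \<le> card V ^ m * 2 ^ (m choose 2)"
  proof (cases "m \<le> card V")
    case True
    then show ?thesis
      by (simp add: binomial_le_pow)
  next
    case False
    then show ?thesis
      by (simp add: binomial_eq_0)
  qed
  finally show ?thesis .
qed

lemma choose_two_lower_bound:
  assumes "n \<ge> 2"
  shows "real n ^ 2 / 4 \<le> real (n choose 2)"
proof -
  have "real (n choose 2) = real n * (real n - 1) / 2"
    using assms by (simp add: choose_two real_of_nat_div)
  moreover have "real n * (real n / 2) \<le> real n * (real n - 1)"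
    using assms by (intro mult_left_mono) auto
  ultimately show ?thesis
    by (simp add: power2_eq_square)
qed

text \<open>The deletion method is applied to the edges of the complete graph; forbidden are the
  sets of \<open>h\<close> edges lying on \<open>m\<close> vertices. The loss depends on
  \<open>m\<close> alone, so the order in \<open>n\<close> survives.\<close>

lemma locally_sparse_graph:
  fixes n m h s :: nat
  assumes n: "n \<ge> 2" and m: "m \<ge> 2" and s: "s > 0" and h: "h \<ge> 2" "s * (m - 2) + 1 \<le> h"
  obtains R where "R \<subseteq> [{..<n}]\<^bsup>2\<^esup>"
    "\<And>W B. W \<in> [{..<n}]\<^bsup>m\<^esup> \<Longrightarrow> B \<subseteq> R \<Longrightarrow> B \<subseteq> [W]\<^bsup>2\<^esup> \<Longrightarrow> card B \<noteq> h"
    "real n powr (2 - 1 / s) \<le> 128 * 2 ^ (m choose 2) * real (card R)"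
proof -
  define E where "E = [{..<n}]\<^bsup>2\<^esup>"
  define \<B> where "\<B> = {B \<in> [E]\<^bsup>h\<^esup>. \<exists>W\<in>[{..<n}]\<^bsup>m\<^esup>. B \<subseteq> [W]\<^bsup>2\<^esup>}"
  define K :: real where "K = 2 ^ (m choose 2)"
  define a where "a = real n powr (1 / s)"
  \<comment> \<open>The factor \<open>8 * K\<close> is what \<open>few\<close> requires:
    \<open>2 * n^m * K\<close> equals \<open>n^2/4\<close> times \<open>8 * K * n^(m-2)\<close>.
    Since \<open>K * a\<close> is at least 1, rounding up at most doubles the value.\<close>
  define L where "L = nat \<lceil>8 * K * a\<rceil>"
  have K: "K \<ge> 1"
    by (simp add: K_def)
  have a: "a \<ge> 1"
    using n by (simp add: a_def ge_one_powr_ge_zero)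
  have Ka: "K * a \<ge> 1"
    using K a mult_mono[of 1 K 1 a] by simp
  have L1: "8 * K * a \<le> real L"
    unfolding L_def by linarith
  have L2: "real L \<le> 16 * K * a"
    unfolding L_def using Ka by linarith
  have L0: "L > 0"
    using L1 Ka by linarith
  have finE: "finite E"
    by (simp add: E_def finite_imp_finite_nsets)
  have cardE: "real n ^ 2 / 4 \<le> real (card E)"
    using choose_two_lower_bound[OF n] by (simp add: E_def)
  have apow: "a ^ s = real n"
    using s n by (simp add: a_def powr_realpow[symmetric] powr_powr)
  \<comment> \<open>Here the density condition enters: \<open>h - 1\<close> is at least
    \<open>s * (m - 2)\<close>, and \<open>a ^ s = n\<close>.\<close>
  have npow: "real n ^ (m - 2) \<le> a ^ (h - 1)"
  proof -
    have "real n ^ (m - 2) = a ^ (s * (m - 2))"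
      by (simp add: power_mult apow)
    also have "\<dots> \<le> a ^ (h - 1)"
      using h a by (intro power_increasing) auto
    finally show ?thesis .
  qed
  have "8 * K * real n ^ (m - 2) \<le> (8 * K) ^ (h - 1) * a ^ (h - 1)"
  proof (intro mult_mono npow)
    \<comment> \<open>As \<open>h \<ge> 2\<close>, the exponent is at least 1, so a single factor
      \<open>8 * K\<close> is absorbed.\<close>
    show "8 * K \<le> (8 * K) ^ (h - 1)"
      using K h by (intro self_le_power) auto
  qed (use K in auto)
  also have "\<dots> = (8 * K * a) ^ (h - 1)"
    by (simp add: power_mult_distrib)
  also have "\<dots> \<le> real L ^ (h - 1)"
    using L1 Ka by (intro power_mono) auto
  finally have Lpow: "8 * K * real n ^ (m - 2) \<le> real L ^ (h - 1)" .
  have "card \<B> \<le> n ^ m * 2 ^ (m choose 2)"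
    using card_spanned_le[of "{..<n}" h m] by (simp add: \<B>_def E_def)
  from of_nat_mono[OF this, where 'a = real] have "real (card \<B>) \<le> real n ^ m * K"
    by (simp add: K_def)
  also have "real n ^ m = real n ^ 2 * real n ^ (m - 2)"
    using m by (metis le_add_diff_inverse power_add)
  finally have "2 * real (card \<B>) \<le> (real n ^ 2 / 4) * (8 * K * real n ^ (m - 2))"
    by (simp add: mult_ac)
  also have "\<dots> \<le> real (card E) * real L ^ (h - 1)"
    using cardE Lpow K by (intro mult_mono) auto
  finally have "real (2 * card \<B>) \<le> real (card E * L ^ (h - 1))"
    by simp
  then have few: "2 * card \<B> \<le> card E * L ^ (h - 1)"
    unfolding of_nat_le_iff .
  obtain R where R: "R \<subseteq> E" "\<And>B. B \<in> \<B> \<Longrightarrow> \<not> B \<subseteq> R" "card E \<le> 2 * L * card R"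
    using few h L0 by (elim deletion_method[OF finE, rotated -1]) (auto simp: \<B>_def nsets_def)
  show thesis
  proof
    show "R \<subseteq> [{..<n}]\<^bsup>2\<^esup>"
      using R(1) by (simp add: E_def)
    show "card B \<noteq> h" if "W \<in> [{..<n}]\<^bsup>m\<^esup>" "B \<subseteq> R" "B \<subseteq> [W]\<^bsup>2\<^esup>" for W B
    proof
      assume "card B = h"
      then have "B \<in> \<B>"
        using that R(1) finE by (auto simp: \<B>_def nsets_def[of E] intro: finite_subset)
      then show False
        using R(2) that(2) by blast
    qed
    \<comment> \<open>The constant 128 is the product of 4 from the edge count, 2 from deletion and
      16 from the bound on \<open>L\<close>.\<close>
    have "real n ^ 2 / 4 \<le> 2 * real L * real (card R)"
      using cardE of_nat_mono[OF R(3), where 'a = real] by simp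
    also have "\<dots> \<le> 2 * (16 * K * a) * real (card R)"
      using L2 by (intro mult_right_mono) auto
    finally have "real n ^ 2 / a \<le> 128 * K * real (card R)"
      using a by (simp add: field_simps)
    moreover have "real n powr (2 - 1 / s) = real n ^ 2 / a"
      using n by (simp add: a_def powr_diff)
    ultimately show "real n powr (2 - 1 / s) \<le> 128 * 2 ^ (m choose 2) * real (card R)"
      by (simp add: K_def)
  qed
qed

section \<open>Colourings without a balanced copy\<close>

lemma graph_iso_card:
  assumes "finite_simple_graph G" "graph_iso G H"
  shows "card (verts H) = card (verts G)" "card (edges H) = card (edges G)"
proof -
  obtain f where f: "bij_betw f (verts G) (verts H)" "edges H = (\<lambda>e. f ` e) ` edges G"
    using assms(2) by (auto simp: graph_iso_def)
  show "card (verts H) = card (verts G)"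
    using bij_betw_same_card[OF f(1)] by simp
  have "inj_on ((`) f) (edges G)"
  proof (rule inj_on_subset)
    show "inj_on ((`) f) (Pow (verts G))"
      using f(1) by (intro inj_on_image_Pow) (auto simp: bij_betw_def)
    show "edges G \<subseteq> Pow (verts G)"
      using assms(1) by (auto simp: finite_simple_graph_def nsets_def)
  qed
  then show "card (edges H) = card (edges G)"
    by (simp add: f(2) card_image)
qed

text \<open>If the class of exactly half the edges, rounded down, is blue, the red class has half
  rounded up. Either way a copy contains enough red edges on \<open>card (verts G)\<close> vertices
  to violate the sparsity of \<open>R\<close>.\<close>

lemma no_balanced_copy:
  assumes G: "finite_simple_graph G"
    and R: "\<And>W B. W \<in> [{..<n}]\<^bsup>card (verts G)\<^esup> \<Longrightarrow> B \<subseteq> R \<Longrightarrow> B \<subseteq> [W]\<^bsup>2\<^esup>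
      \<Longrightarrow> card B \<noteq> card (edges G) div 2"
  shows "\<not> balanced_copy n (\<lambda>e. if e \<in> R then Red else Blue) G"
proof
  let ?c = "\<lambda>e. if e \<in> R then Red else Blue"
  assume "balanced_copy n ?c G"
  then obtain H x where H: "subgraph H (complete_graph n)" "graph_iso G H"
    and x: "card {e \<in> edges H. ?c e = x} = card (edges G) div 2"
    by (auto simp: balanced_copy_def)
  have Hs: "finite (verts H)" "edges H \<subseteq> [verts H]\<^bsup>2\<^esup>" "verts H \<subseteq> {..<n}"
    using H(1) by (auto simp: subgraph_def finite_simple_graph_def complete_graph_def)
  then have finH: "finite (edges H)"
    by (meson finite_imp_finite_nsets finite_subset)
  have "card (edges H) = card (edges H \<inter> R) + card (edges H - R)"
    using finH by (metis card_Int_Diff)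
  moreover have "{e \<in> edges H. ?c e = x} = (case x of Red \<Rightarrow> edges H \<inter> R | Blue \<Rightarrow> edges H - R)"
    by (auto split: colour.split)
  ultimately have "card (edges G) div 2 \<le> card (edges H \<inter> R)"
    using x graph_iso_card[OF G H(2)] by (auto split: colour.splits)
  then obtain B where "B \<subseteq> edges H \<inter> R" "card B = card (edges G) div 2"
    by (meson obtain_subset_with_card_n)
  moreover have "verts H \<in> [{..<n}]\<^bsup>card (verts G)\<^esup>"
    using Hs graph_iso_card[OF G H(2)] by (simp add: nsets_def)
  ultimately show False
    using R[of "verts H" B] Hs(2) by blast
qed

text \<open>\<open>more_than_each\<close> is antitone in its threshold, so \<open>c\<close> also
  refutes every threshold below \<open>k\<close>.\<close>

lemma bal_greater:
  assumes "more_than_each n k c" "\<not> balanced_copy n c G"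
  shows "enat (Suc k) \<le> bal n G"
  unfolding bal_def
proof (rule Inf_greatest)
  fix y assume "y \<in> {enat k | k. (\<exists>c. more_than_each n k c) \<and>
    (\<forall>c. more_than_each n k c \<longrightarrow> balanced_copy n c G)}"
  then obtain k' where k': "y = enat k'" "more_than_each n k' c \<longrightarrow> balanced_copy n c G"
    by blast
  then have "\<not> k' \<le> k"
    using assms by (auto simp: more_than_each_def intro: le_less_trans)
  then show "enat (Suc k) \<le> y"
    by (simp add: k'(1))
qed

text \<open>The red graph is trimmed to \<open>M\<close> edges, which preserves its sparsity and
  leaves at least \<open>M\<close> blue edges.\<close>

lemma bal_real_lower_bound:
  fixes G :: "'a ugraph"
  assumes G: "finite_simple_graph G" and fin: "bal n G \<noteq> \<infinity>"
    and n: "n \<ge> 4" and m: "card (verts G) \<ge> 2" and s: "s > 0"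
    and h: "card (edges G) div 2 \<ge> 2"
      "s * (card (verts G) - 2) + 1 \<le> card (edges G) div 2"
  shows "real n powr (2 - 1 / s) / (128 * 2 ^ (card (verts G) choose 2)) \<le> bal_real n G"
proof -
  define q where "q = real n powr (2 - 1 / s) / (128 * 2 ^ (card (verts G) choose 2))"
  define M where "M = nat \<lceil>q\<rceil>"
  let ?E = "[{..<n}]\<^bsup>2\<^esup>"
  obtain R where R: "R \<subseteq> ?E"
    "\<And>W B. W \<in> [{..<n}]\<^bsup>card (verts G)\<^esup> \<Longrightarrow> B \<subseteq> R \<Longrightarrow> B \<subseteq> [W]\<^bsup>2\<^esup>
      \<Longrightarrow> card B \<noteq> card (edges G) div 2"
    "real n powr (2 - 1 / s) \<le> 128 * 2 ^ (card (verts G) choose 2) * real (card R)"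
    using locally_sparse_graph[OF _ m s h, of n] n by auto
  have q0: "q > 0"
    using n by (simp add: q_def)
  have "q \<le> real (card R)"
    using R(3) by (simp add: q_def field_simps)
  then have "M \<le> card R"
    by (simp add: M_def nat_le_iff ceiling_le_iff)
  then obtain R' where R': "R' \<subseteq> R" "card R' = M" "finite R'"
    by (meson obtain_subset_with_card_n)
  have M0: "M > 0"
    using q0 by (simp add: M_def)
  have "real n powr (2 - 1 / s) \<le> real n powr 2"
    using n s by (intro powr_mono) auto
  then have "real n powr (2 - 1 / s) \<le> 4 * real (n choose 2)"
    using choose_two_lower_bound[of n] n by simp
  moreover have "q \<le> real n powr (2 - 1 / s) / 128"
    unfolding q_def by (intro divide_left_mono) auto
  ultimately have "q \<le> real (n choose 2) / 32"
    by linarith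
  moreover have "real (n choose 2) \<ge> 4"
  proof -
    have "4 \<le> real n ^ 2 / 4"
      using power_mono[of 4 "real n" 2] n by simp
    then show ?thesis
      using choose_two_lower_bound[of n] n by linarith
  qed
  \<comment> \<open>Rounding \<open>q\<close> up adds less than 1, which is absorbed because
    \<open>n choose 2\<close> is at least 4.\<close>
  ultimately have M2: "2 * M \<le> n choose 2"
    unfolding M_def using q0 by linarith
  let ?c = "\<lambda>e. if e \<in> R' then Red else Blue"
  \<comment> \<open>The threshold is \<open>M - 1\<close> because the inequality is strict;
    \<open>bal_greater\<close> restores the lost unit.\<close>
  have "more_than_each n (M - 1) ?c"
    unfolding more_than_each_def
  proof
    fix x
    have "{e \<in> ?E. ?c e = x} = (case x of Red \<Rightarrow> R' | Blue \<Rightarrow> ?E - R')"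
      using R' R(1) by (auto split: colour.split)
    moreover have "card (?E - R') = (n choose 2) - M"
      using R' R(1) by (subst card_Diff_subset) auto
    ultimately show "M - 1 < card {e \<in> edges (complete_graph n). ?c e = x}"
      using M0 M2 R'(2) by (auto simp: complete_graph_def split: colour.split)
  qed
  moreover have "\<not> balanced_copy n ?c G"
    using R(2) R'(1) by (intro no_balanced_copy[OF G]) blast
  ultimately have "enat (Suc (M - 1)) \<le> bal n G"
    by (rule bal_greater)
  then have "M \<le> the_enat (bal n G)"
    using fin M0 by (cases "bal n G") auto
  moreover have "q \<le> real M"
    unfolding M_def by linarith
  ultimately show ?thesis
    by (simp add: q_def bal_real_def)
qed

section \<open>Passage to asymptotic bounds\<close>

text \<open>For fixed \<open>G\<close> the factor \<open>128 * 2 ^ (m choose 2)\<close> is constant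
  in \<open>n\<close>. The linear edge bound leaves ample room for halving and rounding.\<close>

lemma bal_bigomega:
  fixes G :: "'a ugraph"
  assumes G: "finite_simple_graph G" "balanceable G"
    and s: "s > 0" and e: "real (card (edges G)) \<ge> 4 * (real s + 1) * real (card (verts G))"
  shows "(\<lambda>n. bal_real n G) \<in> \<Omega>(\<lambda>n. real n powr (2 - 1 / real s))"
proof -
  define m where "m = card (verts G)"
  have "m > 0"
    using G(1) by (simp add: m_def finite_simple_graph_def card_gt_0_iff)
  have "real (4 * (s + 1) * m) \<le> real (card (edges G))"
    using e by (simp add: m_def algebra_simps)
  then have e': "4 * (s * m) + 4 * m \<le> card (edges G)"
    unfolding of_nat_le_iff by (simp add: algebra_simps)
  have "card (edges G) \<le> m choose 2"
    using G(1) card_mono[of "[verts G]\<^bsup>2\<^esup>" "edges G"]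
    by (simp add: m_def finite_simple_graph_def finite_imp_finite_nsets)
  \<comment> \<open>A single vertex spans no edge, contradicting \<open>e'\<close>.\<close>
  then have m2: "m \<ge> 2"
    using e' \<open>m > 0\<close> by (cases "m = 1") (auto simp: choose_two)
  have h: "card (edges G) div 2 \<ge> 2" "s * (m - 2) + 1 \<le> card (edges G) div 2"
  proof -
    show "card (edges G) div 2 \<ge> 2"
      using e' m2 by linarith
    have "s * (m - 2) \<le> s * m"
      by simp
    then show "s * (m - 2) + 1 \<le> card (edges G) div 2"
      using e' m2 by linarith
  qed
  have "\<forall>\<^sub>F n in sequentially.
    real n powr (2 - 1 / s) / (128 * 2 ^ (m choose 2)) \<le> bal_real n G"
    using G(2)[unfolded balanceable_def] eventually_ge_at_top[of 4]
    by eventually_elim (use bal_real_lower_bound[OF G(1)] m2 s h in \<open>auto simp: m_def\<close>)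
  then show ?thesis
    by (intro landau_omega.bigI[of "1 / (128 * 2 ^ (m choose 2))"])
      (auto elim!: eventually_mono simp: bal_real_def)
qed

theorem theorem3p2:
  fixes G :: "nat \<Rightarrow> 'a ugraph" and s :: nat
  assumes graph: "\<And>t. t > 0 \<Longrightarrow> finite_simple_graph (G t)"
    and bal: "\<And>t. t > 0 \<Longrightarrow> balanceable (G t)"
    and mono_order: "mono_on {0<..} (\<lambda>t. card (verts (G t)))"
    and mono_size: "mono_on {0<..} (\<lambda>t. card (edges (G t)))"
    and s: "s \<ge> 2"
    and dense: "(\<lambda>t. real (card (verts (G t))) powr (2 - 1 / real s))
                  \<in> o(\<lambda>t. real (card (edges (G t))))"
  shows "\<forall>\<^sub>F t in sequentially.
           (\<lambda>n. bal_real n (G t)) \<in> \<Omega>(\<lambda>n. real n powr (2 - 1 / real s))"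
proof -
  \<comment> \<open>The little-o constant is chosen to match the edge bound in
    \<open>bal_bigomega\<close>.\<close>
  have "\<forall>\<^sub>F t in sequentially. norm (real (card (verts (G t))) powr (2 - 1 / real s))
      \<le> 1 / (4 * (real s + 1)) * norm (real (card (edges (G t))))"
    using dense by (rule landau_o.smallD) simp
  then show ?thesis
    using eventually_gt_at_top[of 0]
  proof eventually_elim
    case (elim t)
    let ?m = "card (verts (G t))"
    have "?m > 0"
      using graph[of t] elim by (simp add: finite_simple_graph_def card_gt_0_iff)
    \<comment> \<open>The exponent \<open>2 - 1/s\<close> is at least 1, so the density hypothesis
      yields a linear bound in the order.\<close>
    then have "real ?m powr 1 \<le> real ?m powr (2 - 1 / real s)"
      using s by (intro powr_mono) auto
    then have "real ?m \<le> 1 / (4 * (real s + 1)) * real (card (edges (G t)))"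
      using elim(1) by simp
    then have "4 * (real s + 1) * real ?m \<le> real (card (edges (G t)))"
      by (simp add: field_simps)
    then show ?case
      using graph bal elim s by (intro bal_bigomega) auto
  qed
qed

end
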